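(* With the profiles $\rho_n$, maximizer sets $A_n$, Gaussian vectors $X_n\sim N(\mu_n,\Sigma_n)$ and maps $\Theta_n$ as in the context, fix $c\in(0,1)$. For every $n$ and every $\delta>0$, $$|f_n(\delta)-g_n(\delta)|\le\eta_{n,\delta}^{(c)}+\frac{\left(K_n\sqrt{\operatorname{tr}(\Sigma_n)}+d_n\right)^2}{\delta^2}.$$ Consequently, if $\eta_{n,\delta}^{(c)}\to0$ as $n\to\infty$ for every fixed $\delta>0$, $K_n^2\operatorname{tr}(\Sigma_n)\to0$, and $d_n\to0$, then $|f_n(\delta)-g_n(\delta)|\to0$ as $n\to\infty$ for every fixed $\delta>0$.
   Context: Profiles: $I=[a,b]\subset\mathbb{R}$ is a fixed compact interval and, for each $n\in\mathbb{N}$, $\rho_n:I\to[0,\infty)$ is continuous with $0<\int_I\rho_n<\infty$. $|E|$ denotes Lebesgue measure of $E\subset\mathbb{R}$. Set $m_n=\max_I\rho_n$, $A_n=\{\theta\in I:\rho_n(\theta)=m_n\}$, and for $\delta>0$ $$U_\delta^I(A_n)=\{\theta\in I:\operatorname{dist}(\theta,A_n)<\delta\},\qquad f_n(\delta)=\frac{\int_{U_\delta^I(A_n)}\rho_n}{\int_I\rho_n},\qquad T_{n,\delta}=I\setminus U_\delta^I(A_n),$$ $$L_{n,\delta}^{(c)}=\{\theta\in U_\delta^I(A_n):\rho_n(\theta)\ge c\,m_n\},\qquad \eta_{n,\delta}^{(c)}=\frac{|T_{n,\delta}|}{c\,|L_{n,\delta}^{(c)}|}\sup_{\theta\in T_{n,\delta}}\frac{\rho_n(\theta)}{m_n},$$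 with $\eta_{n,\delta}^{(c)}=0$ if $T_{n,\delta}=\varnothing$. Gaussian observation: $X_n\sim N(\mu_n,\Sigma_n)$ with $\mu_n\in\mathbb{R}^n$ and $\Sigma_n$ an $n\times n$ symmetric positive semidefinite matrix; $\Theta_n:\mathbb{R}^n\to\mathbb{R}$ is $C^1$ with $K_n:=\sup_{z\in\mathbb{R}^n}\|\nabla\Theta_n(z)\|<\infty$; $d_n:=\operatorname{dist}(\Theta_n(\mu_n),A_n)$; and $g_n(\delta):=\mathbb{P}\bigl(\operatorname{dist}(\Theta_n(X_n),A_n)<\delta\bigr)$. *)

theory Defs
  imports "HOL-Probability.Probability"
begin

section \<open>Profiles on a compact set\<close>

text \<open>Below, \<open>I\<close> is a compact set (an interval in the application) and \<open>\<rho>\<close> is continuous and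
  nonnegative on \<open>I\<close>; the values of \<open>\<rho>\<close> outside \<open>I\<close> are never used.\<close>

text \<open>For continuous \<open>\<rho>\<close> and compact nonempty \<open>I\<close> the supremum is attained, i.e. is a maximum.\<close>

definition peak :: "real set \<Rightarrow> (real \<Rightarrow> real) \<Rightarrow> real" where
  "peak I \<rho> = (SUP \<theta>\<in>I. \<rho> \<theta>)"

definition maximizers :: "real set \<Rightarrow> (real \<Rightarrow> real) \<Rightarrow> real set" where
  "maximizers I \<rho> = {\<theta>\<in>I. \<rho> \<theta> = peak I \<rho>}"

definition peak_nbhd :: "real set \<Rightarrow> (real \<Rightarrow> real) \<Rightarrow> real \<Rightarrow> real set" where
  "peak_nbhd I \<rho> \<delta> = {\<theta>\<in>I. infdist \<theta> (maximizers I \<rho>) < \<delta>}"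

definition peak_mass :: "real set \<Rightarrow> (real \<Rightarrow> real) \<Rightarrow> real \<Rightarrow> real" where
  "peak_mass I \<rho> \<delta> =
    (LINT \<theta>:peak_nbhd I \<rho> \<delta>|lborel. \<rho> \<theta>) / (LINT \<theta>:I|lborel. \<rho> \<theta>)"

definition peak_tail :: "real set \<Rightarrow> (real \<Rightarrow> real) \<Rightarrow> real \<Rightarrow> real set" where
  "peak_tail I \<rho> \<delta> = I - peak_nbhd I \<rho> \<delta>"

definition peak_core :: "real \<Rightarrow> real set \<Rightarrow> (real \<Rightarrow> real) \<Rightarrow> real \<Rightarrow> real set" where
  "peak_core c I \<rho> \<delta> = {\<theta>\<in>peak_nbhd I \<rho> \<delta>. c * peak I \<rho> \<le> \<rho> \<theta>}"

definition tail_ratio :: "real \<Rightarrow> real set \<Rightarrow> (real \<Rightarrow> real) \<Rightarrow> real \<Rightarrow> real" where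
  "tail_ratio c I \<rho> \<delta> =
    (if peak_tail I \<rho> \<delta> = {} then 0
     else measure lborel (peak_tail I \<rho> \<delta>) / (c * measure lborel (peak_core c I \<rho> \<delta>))
          * (SUP \<theta>\<in>peak_tail I \<rho> \<delta>. \<rho> \<theta> / peak I \<rho>))"


section \<open>Calculus on \<open>n\<close>-dimensional space for varying \<open>n\<close>\<close>

text \<open>Since the dimension varies along a sequence, it cannot be a type. As in
  \<^const>\<open>Euclidean_space\<close>, a vector of dimension \<open>n\<close> is a function \<open>nat \<Rightarrow> real\<close> vanishing at all
  indices \<open>i \<ge> n\<close>. An \<open>n\<close> by \<open>n\<close> matrix is a function of two indices whose entries
  outside \<open>{..<n} \<times> {..<n}\<close> are ignored.\<close>

abbreviation Rn :: "nat \<Rightarrow> (nat \<Rightarrow> real) set" where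
  "Rn n \<equiv> topspace (Euclidean_space n)"

text \<open>For \<open>z \<in> Rn n\<close> and \<open>i < n\<close> the update \<open>z(i := t)\<close> stays in \<open>Rn n\<close>, so that
  only the values of \<open>F\<close> on \<open>Rn n\<close> matter.\<close>

definition partial_deriv :: "nat \<Rightarrow> ((nat \<Rightarrow> real) \<Rightarrow> real) \<Rightarrow> (nat \<Rightarrow> real) \<Rightarrow> real" where
  "partial_deriv i F z = deriv (\<lambda>t. F (z(i := t))) (z i)"

definition C1_on_Rn :: "nat \<Rightarrow> ((nat \<Rightarrow> real) \<Rightarrow> real) \<Rightarrow> bool" where
  "C1_on_Rn n F \<longleftrightarrow>
    (\<forall>i<n. (\<forall>z\<in>Rn n. (\<lambda>t. F (z(i := t))) differentiable (at (z i))) \<and>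
           continuous_map (Euclidean_space n) euclideanreal (partial_deriv i F))"

definition grad_norm :: "nat \<Rightarrow> ((nat \<Rightarrow> real) \<Rightarrow> real) \<Rightarrow> (nat \<Rightarrow> real) \<Rightarrow> real" where
  "grad_norm n F z = L2_set (\<lambda>i. partial_deriv i F z) {..<n}"

text \<open>Being a supremum of reals, this is meaningful only if the gradient norms are bounded.\<close>

definition grad_sup :: "nat \<Rightarrow> ((nat \<Rightarrow> real) \<Rightarrow> real) \<Rightarrow> real" where
  "grad_sup n F = (SUP z\<in>Rn n. grad_norm n F z)"


section \<open>Covariance matrices and Gaussian vectors\<close>

definition quad_form :: "nat \<Rightarrow> (nat \<Rightarrow> nat \<Rightarrow> real) \<Rightarrow> (nat \<Rightarrow> real) \<Rightarrow> real" where
  "quad_form n S x = (\<Sum>i<n. \<Sum>j<n. x i * S i j * x j)"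

definition sym_psd :: "nat \<Rightarrow> (nat \<Rightarrow> nat \<Rightarrow> real) \<Rightarrow> bool" where
  "sym_psd n S \<longleftrightarrow>
    (\<forall>i<n. \<forall>j<n. S i j = S j i) \<and> (\<forall>x\<in>Rn n. 0 \<le> quad_form n S x)"

definition mat_trace :: "nat \<Rightarrow> (nat \<Rightarrow> nat \<Rightarrow> real) \<Rightarrow> real" where
  "mat_trace n S = (\<Sum>i<n. S i i)"

text \<open>The normal law on the real line with mean \<open>m\<close> and variance \<open>v \<ge> 0\<close>; the point mass at \<open>m\<close>
  if \<open>v = 0\<close>.\<close>

definition normal_law :: "real \<Rightarrow> real \<Rightarrow> real measure" where
  "normal_law m v =
    (if v = 0 then return borel m else density lborel (normal_density m (sqrt v)))"

text \<open>\<open>X\<close> is \<open>N(\<mu>, S)\<close>-distributed, with \<open>S\<close> possibly singular: every linear functional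
  of \<open>X\<close> with coefficient vector \<open>u\<close> is normal with mean \<open>u\<^sup>T \<mu>\<close> and variance \<open>u\<^sup>T S u\<close>.
  The type \<open>nat \<Rightarrow> real\<close> carries the product topology, so the measurable space used
  here is \<open>Rn n\<close> with its usual Borel sets.\<close>

definition gaussian_vector ::
  "nat \<Rightarrow> 'a measure \<Rightarrow> ('a \<Rightarrow> nat \<Rightarrow> real) \<Rightarrow> (nat \<Rightarrow> real) \<Rightarrow> (nat \<Rightarrow> nat \<Rightarrow> real) \<Rightarrow> bool"
where
  "gaussian_vector n M X \<mu> S \<longleftrightarrow>
    X \<in> M \<rightarrow>\<^sub>M restrict_space borel (Rn n) \<and>
    (\<forall>u\<in>Rn n. distr M borel (\<lambda>\<omega>. \<Sum>i<n. u i * X \<omega> i)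
               = normal_law (\<Sum>i<n. u i * \<mu> i) (quad_form n S u))"

definition obs_mass ::
  "'a measure \<Rightarrow> ('a \<Rightarrow> nat \<Rightarrow> real) \<Rightarrow> ((nat \<Rightarrow> real) \<Rightarrow> real) \<Rightarrow> real set \<Rightarrow> real \<Rightarrow> real"
where
  "obs_mass M X F A \<delta> = measure M {\<omega>\<in>space M. infdist (F (X \<omega>)) A < \<delta>}"

end

theory Submission
  imports Defs
begin

text \<open>Both masses are compared with 1. The tail carries at most \<open>|T| sup\<^sub>T \<rho>\<close>, while the whole integral is at
  least \<open>c m |L|\<close>, so \<open>1 - f(\<delta>) \<le> \<eta>\<close>. For the observation, \<open>\<Theta>\<close> is Lipschitz with constant \<open>K\<close>, hence
  \<open>dist(\<Theta>(X), A) \<le> K \<parallel>X - \<mu>\<parallel> + d\<close>; since \<open>E \<parallel>X - \<mu>\<parallel>\<^sup>2 = tr \<Sigma>\<close>, the Markov inequality for the square of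
  the right-hand side bounds \<open>1 - g(\<delta>)\<close>.\<close>

section \<open>Mass away from the maximizers\<close>

locale profile =
  fixes a b :: real and \<rho> :: "real \<Rightarrow> real"
  assumes cont: "continuous_on {a..b} \<rho>"
    and nonneg: "\<And>\<theta>. \<theta> \<in> {a..b} \<Longrightarrow> 0 \<le> \<rho> \<theta>"
    and integrable: "set_integrable lborel {a..b} \<rho>"
    and mass_pos: "0 < (LINT \<theta>:{a..b}|lborel. \<rho> \<theta>)"
begin

text \<open>An empty or one-point interval is a null set and would carry no mass. Strictness is what
  later gives a neighbourhood of a maximizer positive length, even at an endpoint.\<close>

lemma endpoints_less: "a < b"
proof (rule ccontr)
  assume "\<not> a < b"
  moreover have "\<not> b < a"
    using mass_pos by (auto simp: set_lebesgue_integral_def)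
  ultimately have "{a..b} = {a}"
    by auto
  then have "(LINT \<theta>:{a..b}|lborel. \<rho> \<theta>) = (LINT \<theta>:{a}|lborel. \<rho> a)"
    unfolding \<open>{a..b} = {a}\<close> by (intro set_lebesgue_integral_cong) auto
  also have "\<dots> = 0"
    by (subst set_integral_const) auto
  finally show False
    using mass_pos by simp
qed

section \<open>Attainment and positivity of the peak\<close>

lemma le_peak: "\<theta> \<in> {a..b} \<Longrightarrow> \<rho> \<theta> \<le> peak {a..b} \<rho>"
  unfolding peak_def
  by (intro cSUP_upper bounded_imp_bdd_above compact_imp_bounded compact_continuous_image cont)
    auto

lemma maximizers_nonempty: "maximizers {a..b} \<rho> \<noteq> {}"
proof -
  obtain \<theta> where \<theta>: "\<theta> \<in> {a..b}" "\<And>y. y \<in> {a..b} \<Longrightarrow> \<rho> y \<le> \<rho> \<theta>"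
    using continuous_attains_sup[OF compact_Icc _ cont] endpoints_less by fastforce
  then have "peak {a..b} \<rho> = \<rho> \<theta>"
    unfolding peak_def by (intro cSup_eq_maximum) auto
  with \<theta> show ?thesis
    by (auto simp: maximizers_def)
qed

lemma peak_pos: "0 < peak {a..b} \<rho>"
proof (rule ccontr)
  assume "\<not> 0 < peak {a..b} \<rho>"
  then have "\<rho> \<theta> = 0" if "\<theta> \<in> {a..b}" for \<theta>
    using that le_peak[of \<theta>] nonneg[of \<theta>] by linarith
  then have "(LINT \<theta>:{a..b}|lborel. \<rho> \<theta>) = (LINT \<theta>:{a..b}|lborel. 0)"
    by (intro set_lebesgue_integral_cong) auto
  with mass_pos show False
    by (simp add: set_lebesgue_integral_def)
qed

section \<open>Measurability and finite measure of the neighbourhood, tail and core\<close>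

lemma peak_nbhd_borel [measurable]: "peak_nbhd {a..b} \<rho> \<delta> \<in> sets borel"
proof -
  have "{\<theta>. infdist \<theta> (maximizers {a..b} \<rho>) < \<delta>} \<in> sets borel"
    by (intro borel_open open_Collect_less continuous_intros)
  moreover have "peak_nbhd {a..b} \<rho> \<delta> = {a..b} \<inter> {\<theta>. infdist \<theta> (maximizers {a..b} \<rho>) < \<delta>}"
    by (auto simp: peak_nbhd_def)
  ultimately show ?thesis
    by auto
qed

lemma peak_tail_borel [measurable]: "peak_tail {a..b} \<rho> \<delta> \<in> sets borel"
  unfolding peak_tail_def by measurable

lemma peak_core_borel [measurable]: "peak_core c {a..b} \<rho> \<delta> \<in> sets borel"
proof -
  \<comment> \<open>Continuity is known only on \<open>{a..b}\<close>, so the superlevel set is a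
    relatively closed subset of a closed interval, hence closed in the line.\<close>
  have "closed {\<theta> \<in> {a..b}. c * peak {a..b} \<rho> \<le> \<rho> \<theta>}"
    using continuous_closed_preimage[OF cont, of "{c * peak {a..b} \<rho>..}"]
    by (simp add: vimage_def Int_def)
  then have "{\<theta> \<in> {a..b}. c * peak {a..b} \<rho> \<le> \<rho> \<theta>} \<in> sets borel"
    by simp
  moreover have "peak_core c {a..b} \<rho> \<delta>
      = peak_nbhd {a..b} \<rho> \<delta> \<inter> {\<theta> \<in> {a..b}. c * peak {a..b} \<rho> \<le> \<rho> \<theta>}"
    by (auto simp: peak_core_def peak_nbhd_def)
  ultimately show ?thesis
    by auto
qed

lemma subset_Icc:
  "peak_nbhd {a..b} \<rho> \<delta> \<subseteq> {a..b}"
  "peak_tail {a..b} \<rho> \<delta> \<subseteq> {a..b}"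
  "peak_core c {a..b} \<rho> \<delta> \<subseteq> {a..b}"
  by (auto simp: peak_nbhd_def peak_tail_def peak_core_def)

lemma finite_emeasure_subset_Icc: "A \<subseteq> {a..b} \<Longrightarrow> emeasure lborel A \<noteq> \<infinity>"
  using emeasure_mono[of A "{a..b}" lborel] endpoints_less by (auto simp: top_unique)

lemma set_integrable_const: "A \<in> sets borel \<Longrightarrow> A \<subseteq> {a..b} \<Longrightarrow> set_integrable lborel A (\<lambda>_. r :: real)"
  using finite_emeasure_subset_Icc[of A]
  by (auto simp: set_integrable_def less_top intro!: integrable_mult_left)

text \<open>Near a maximizer, continuity keeps \<open>\<rho>\<close> above the fraction
  \<open>c\<close> of its peak, so the core contains a nondegenerate interval. This keeps the
  denominator of \<open>tail_ratio\<close> away from 0, where division would return the default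
  value 0.\<close>

lemma peak_core_measure_pos:
  assumes "c < 1" "0 < \<delta>"
  shows "0 < measure lborel (peak_core c {a..b} \<rho> \<delta>)"
proof -
  obtain \<theta>\<^sub>0 where \<theta>\<^sub>0: "\<theta>\<^sub>0 \<in> maximizers {a..b} \<rho>"
    using maximizers_nonempty by blast
  then have in_I: "\<theta>\<^sub>0 \<in> {a..b}" and eq: "\<rho> \<theta>\<^sub>0 = peak {a..b} \<rho>"
    by (auto simp: maximizers_def)
  \<comment> \<open>The tolerance for continuity is the whole gap between the peak and
    \<open>c\<close> times the peak.\<close>
  have "0 < (1 - c) * peak {a..b} \<rho>"
    using assms peak_pos by simp
  with cont in_I obtain e where e: "0 < e"
    "\<And>\<theta>. \<theta> \<in> {a..b} \<Longrightarrow> dist \<theta> \<theta>\<^sub>0 < e \<Longrightarrow> dist (\<rho> \<theta>) (\<rho> \<theta>\<^sub>0) < (1 - c) * peak {a..b} \<rho>"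
    unfolding continuous_on_iff by blast
  \<comment> \<open>Halving makes \<open>r\<close> strictly smaller than both radii, so that the
    closed interval \<open>J\<close> satisfies the strict distance bounds.\<close>
  define r where "r = min e \<delta> / 2"
  have r: "0 < r" "r < e" "r < \<delta>"
    using e(1) assms by (auto simp: r_def)
  \<comment> \<open>Clipping to \<open>{a..b}\<close> leaves a piece of positive length on at least
    one side of the maximizer because \<open>a < b\<close>.\<close>
  define J where "J = {max a (\<theta>\<^sub>0 - r)..min b (\<theta>\<^sub>0 + r)}"
  have "J \<subseteq> peak_core c {a..b} \<rho> \<delta>"
  proof
    fix \<theta> assume "\<theta> \<in> J"
    then have \<theta>: "\<theta> \<in> {a..b}" "dist \<theta> \<theta>\<^sub>0 \<le> r"
      by (auto simp: J_def dist_real_def)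
    then have "c * peak {a..b} \<rho> \<le> \<rho> \<theta>"
      using e(2)[of \<theta>] r eq by (auto simp: dist_real_def algebra_simps)
    moreover have "infdist \<theta> (maximizers {a..b} \<rho>) < \<delta>"
      using infdist_le[OF \<theta>\<^sub>0, of \<theta>] \<theta> r by linarith
    ultimately show "\<theta> \<in> peak_core c {a..b} \<rho> \<delta>"
      using \<theta> by (auto simp: peak_core_def peak_nbhd_def)
  qed
  then have "measure lborel J \<le> measure lborel (peak_core c {a..b} \<rho> \<delta>)"
    using finite_emeasure_subset_Icc[OF subset_Icc(3)]
    by (intro measure_mono_fmeasurable) (auto simp: J_def fmeasurable_def less_top)
  moreover have "0 < measure lborel J"
    using r in_I endpoints_less by (auto simp: J_def)
  ultimately show ?thesis
    by simp
qed

section \<open>The share of the mass carried by the tail\<close>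

lemma integral_split:
  "(LINT \<theta>:{a..b}|lborel. \<rho> \<theta>)
    = (LINT \<theta>:peak_nbhd {a..b} \<rho> \<delta>|lborel. \<rho> \<theta>) + (LINT \<theta>:peak_tail {a..b} \<rho> \<delta>|lborel. \<rho> \<theta>)"
proof -
  have "{a..b} = peak_nbhd {a..b} \<rho> \<delta> \<union> peak_tail {a..b} \<rho> \<delta>"
    using subset_Icc(1) by (auto simp: peak_tail_def)
  moreover have "set_integrable lborel (peak_nbhd {a..b} \<rho> \<delta>) \<rho>"
    "set_integrable lborel (peak_tail {a..b} \<rho> \<delta>) \<rho>"
    by (intro set_integrable_subset[OF integrable] subset_Icc; simp)+
  ultimately show ?thesis
    using set_integral_Un[of "peak_nbhd {a..b} \<rho> \<delta>" "peak_tail {a..b} \<rho> \<delta>" lborel \<rho>]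
    by (simp add: peak_tail_def)
qed

lemma set_integral_subset_nonneg: "A \<subseteq> {a..b} \<Longrightarrow> 0 \<le> (LINT \<theta>:A|lborel. \<rho> \<theta>)"
  unfolding set_lebesgue_integral_def
  by (intro integral_nonneg_AE AE_I2) (auto simp: indicator_def nonneg)

lemma peak_mass_bounds:
  assumes "0 < c" "c < 1" "0 < \<delta>"
  shows "peak_mass {a..b} \<rho> \<delta> \<le> 1"
    and "1 - peak_mass {a..b} \<rho> \<delta> \<le> tail_ratio c {a..b} \<rho> \<delta>"
proof -
  let ?T = "peak_tail {a..b} \<rho> \<delta>" and ?L = "peak_core c {a..b} \<rho> \<delta>" and ?m = "peak {a..b} \<rho>"
  let ?Z = "LINT \<theta>:{a..b}|lborel. \<rho> \<theta>" and ?IT = "LINT \<theta>:?T|lborel. \<rho> \<theta>"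
  have tail: "1 - peak_mass {a..b} \<rho> \<delta> = ?IT / ?Z"
    using mass_pos integral_split[of \<delta>] by (simp add: peak_mass_def field_simps)
  have IT_nonneg: "0 \<le> ?IT"
    by (intro set_integral_subset_nonneg subset_Icc)
  show "peak_mass {a..b} \<rho> \<delta> \<le> 1"
    using tail IT_nonneg mass_pos divide_nonneg_pos[of ?IT ?Z] by linarith
  show "1 - peak_mass {a..b} \<rho> \<delta> \<le> tail_ratio c {a..b} \<rho> \<delta>"
  proof (cases "?T = {}")
    case True
    then show ?thesis
      unfolding tail by (simp add: tail_ratio_def set_lebesgue_integral_def)
  next
    case False
    define s where "s = (SUP \<theta>\<in>?T. \<rho> \<theta> / ?m)"
    have le_s: "\<rho> \<theta> / ?m \<le> s" if "\<theta> \<in> ?T" for \<theta>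
      unfolding s_def
    \<comment> \<open>A supremum of reals dominates its members only if they are bounded above; the
      peak bounds these quotients by 1.\<close>
    proof (rule cSUP_upper[OF that], rule bdd_aboveI2)
      show "\<rho> x / ?m \<le> 1" if "x \<in> ?T" for x
        using that le_peak[of x] peak_pos by (auto simp: peak_tail_def)
    qed
    then have "?IT \<le> (LINT \<theta>:?T|lborel. ?m * s)"
      using peak_pos
      by (intro set_integral_mono set_integrable_const set_integrable_subset[OF integrable]
          subset_Icc) (auto simp: field_simps)
    also have "\<dots> = measure lborel ?T * (?m * s)"
      by (subst set_integral_const) (use finite_emeasure_subset_Icc[OF subset_Icc(2)] in auto)
    finally have IT: "?IT \<le> measure lborel ?T * (?m * s)" .
    have "measure lborel ?L * (c * ?m) = (LINT \<theta>:?L|lborel. c * ?m)"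
      by (subst set_integral_const) (use finite_emeasure_subset_Icc[OF subset_Icc(3)] in auto)
    also have "\<dots> \<le> (LINT \<theta>:?L|lborel. \<rho> \<theta>)"
      by (intro set_integral_mono set_integrable_const set_integrable_subset[OF integrable]
          subset_Icc) (use peak_core_borel in \<open>auto simp: peak_core_def\<close>)
    \<comment> \<open>The integral grows from the core to the interval because \<open>\<rho>\<close>
      is nonnegative there.\<close>
    also have "\<dots> \<le> ?Z"
    proof -
      have "set_integrable lborel ?L \<rho>"
        by (intro set_integrable_subset[OF integrable] subset_Icc) auto
      then show ?thesis
        unfolding set_lebesgue_integral_def
        using integrable subset_Icc(3)[of c \<delta>]
        by (intro integral_mono) (auto simp: set_integrable_def indicator_def nonneg)
    qed
    finally have Z: "measure lborel ?L * (c * ?m) \<le> ?Z" .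
    have L_pos: "0 < measure lborel ?L"
      by (rule peak_core_measure_pos) fact+
    \<comment> \<open>The numerator is enlarged and the denominator shrunk to a positive number; the
      peak then cancels.\<close>
    have "?IT / ?Z \<le> measure lborel ?T * (?m * s) / (measure lborel ?L * (c * ?m))"
      using IT Z IT_nonneg L_pos peak_pos assms by (intro frac_le) auto
    also have "\<dots> = measure lborel ?T / (c * measure lborel ?L) * s"
      using peak_pos by (simp add: field_simps)
    finally show ?thesis
      unfolding tail using False by (simp add: tail_ratio_def s_def)
  qed
qed

end

section \<open>Lipschitz bound from the gradient\<close>

text \<open>\<open>Euclidean_space n\<close> is a subspace of the product topology, which is also
  the topology of the type \<open>nat \<Rightarrow> real\<close>. The abstract notion of continuity
  can thus be traded for the type-class one.\<close>

lemma continuous_on_Rn_iff: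
  "continuous_map (Euclidean_space n) euclideanreal f \<longleftrightarrow> continuous_on (Rn n) f"
  by (simp add: Euclidean_space_def euclidean_product_topology)

lemma tendsto_fun_coordinatewise:
  fixes f :: "'a \<Rightarrow> 'i \<Rightarrow> 'b :: topological_space"
  assumes "\<And>i. ((\<lambda>x. f x i) \<longlongrightarrow> l i) F"
  shows "(f \<longlongrightarrow> l) F"
proof -
  have "limitin (product_topology (\<lambda>i. euclidean) UNIV) f l F"
    using assms by (simp add: limitin_componentwise)
  then show ?thesis
    by (simp add: euclidean_product_topology)
qed

text \<open>\<open>C1_on_Rn\<close> differentiates only at the current coordinate
  \<open>z i\<close>. Applying it at the base point \<open>z(i := s)\<close> reaches every
  \<open>s\<close>, since the second update overwrites the first and the curve stays the
  same.\<close>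

lemma C1_on_Rn_coordinate_derivative:
  assumes "C1_on_Rn n F" "z \<in> Rn n" "i < n"
  shows "((\<lambda>t. F (z(i := t))) has_real_derivative partial_deriv i F (z(i := s))) (at s)"
proof -
  have "z(i := s) \<in> Rn n"
    using assms by (auto simp: topspace_Euclidean_space)
  with assms have "(\<lambda>t. F ((z(i := s))(i := t))) differentiable at ((z(i := s)) i)"
    unfolding C1_on_Rn_def by blast
  then show ?thesis
    by (simp add: partial_deriv_def DERIV_deriv_iff_real_differentiable)
qed

text \<open>Continuous partial derivatives give a directional derivative: pass from \<open>x\<close> to \<open>x + s h\<close> one
  coordinate at a time and apply the one-dimensional mean value theorem to each step.\<close>

lemma C1_on_Rn_directional_derivative_0:
  assumes C1: "C1_on_Rn n F" and x: "x \<in> Rn n" and h: "h \<in> Rn n"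
  shows "((\<lambda>s. F (\<lambda>k. x k + s * h k)) has_real_derivative
    (\<Sum>i<n. h i * partial_deriv i F x)) (at 0)"
proof -
  \<comment> \<open>Vertices of a staircase path: \<open>P s 0\<close> is \<open>x\<close>, and
    \<open>P s n\<close> is \<open>x + s h\<close> because \<open>h\<close> vanishes from index
    \<open>n\<close> on.\<close>
  define P where "P s m = (\<lambda>k. if k < m then x k + s * h k else x k)" for s m
  have P_Rn: "P s m \<in> Rn n" for s m
    using x h by (auto simp: P_def topspace_Euclidean_space)
  have "\<exists>\<tau>. \<bar>\<tau> - x m\<bar> \<le> \<bar>s * h m\<bar> \<and>
      F (P s (Suc m)) - F (P s m) = s * h m * partial_deriv m F ((P s m)(m := \<tau>))"
    if "m < n" for s m
  proof -
    have deriv: "((\<lambda>t. F ((P s m)(m := x m + t * (s * h m)))) has_real_derivative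
        partial_deriv m F ((P s m)(m := x m + t * (s * h m))) * (s * h m)) (at t)" for t
      by (rule DERIV_chain2[OF C1_on_Rn_coordinate_derivative[OF C1 P_Rn that]])
        (auto intro!: derivative_eq_intros)
    \<comment> \<open>The edge is parametrized over \<open>[0, 1]\<close>, so the mean value theorem
      applies whatever the sign of \<open>s * h m\<close>, including 0.\<close>
    have "\<exists>t. 0 < t \<and> t < 1 \<and>
        F ((P s m)(m := x m + 1 * (s * h m))) - F ((P s m)(m := x m + 0 * (s * h m)))
        = (1 - 0) * (partial_deriv m F ((P s m)(m := x m + t * (s * h m))) * (s * h m))"
      by (rule MVT2[OF _ deriv]) simp
    then obtain t where t: "0 < t" "t < 1"
      "F ((P s m)(m := x m + s * h m)) - F ((P s m)(m := x m))
        = partial_deriv m F ((P s m)(m := x m + t * (s * h m))) * (s * h m)"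
      by auto
    moreover have "(P s m)(m := x m + s * h m) = P s (Suc m)" "(P s m)(m := x m) = P s m"
      by (auto simp: P_def fun_eq_iff)
    moreover have "\<bar>x m + t * (s * h m) - x m\<bar> \<le> \<bar>s * h m\<bar>"
      using t mult_left_le_one_le[of "\<bar>s * h m\<bar>" t] by (simp add: abs_mult)
    ultimately show ?thesis
      by (intro exI[of _ "x m + t * (s * h m)"]) (auto simp: mult_ac)
  qed
  \<comment> \<open>The bound on \<open>m\<close> moves below the existential so that
    \<open>choice_iff\<close> yields a single function of \<open>s\<close> and
    \<open>m\<close>.\<close>
  then have "\<forall>s m. \<exists>\<tau>. m < n \<longrightarrow> \<bar>\<tau> - x m\<bar> \<le> \<bar>s * h m\<bar> \<and>
      F (P s (Suc m)) - F (P s m) = s * h m * partial_deriv m F ((P s m)(m := \<tau>))"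
    by blast
  then obtain \<tau> where \<tau>: "\<And>s m. m < n \<Longrightarrow> \<bar>\<tau> s m - x m\<bar> \<le> \<bar>s * h m\<bar>"
    "\<And>s m. m < n \<Longrightarrow> F (P s (Suc m)) - F (P s m)
      = s * h m * partial_deriv m F ((P s m)(m := \<tau> s m))"
    unfolding choice_iff by blast
  define \<xi> where "\<xi> s m = (P s m)(m := \<tau> s m)" for s m
  \<comment> \<open>Each coordinate of the intermediate point is within
    \<open>\<bar>s * h k\<bar>\<close> of that of \<open>x\<close>, so the point tends to
    \<open>x\<close> in the product topology and continuity of the partial derivative
    applies.\<close>
  have lim: "((\<lambda>s. partial_deriv m F (\<xi> s m)) \<longlongrightarrow> partial_deriv m F x) (at 0)" if "m < n" for m
  proof (rule continuous_on_tendsto_compose[where f = "partial_deriv m F" and g = "\<lambda>s. \<xi> s m"])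
    show "continuous_on (Rn n) (partial_deriv m F)"
      using C1 that by (simp add: C1_on_Rn_def continuous_on_Rn_iff)
    show "((\<lambda>s. \<xi> s m) \<longlongrightarrow> x) (at 0)"
    proof (rule tendsto_fun_coordinatewise)
      fix k
      have "((\<lambda>s. \<bar>s * h k\<bar>) \<longlongrightarrow> \<bar>0 * h k\<bar>) (at 0)"
        by (intro tendsto_intros)
      then have null: "((\<lambda>s. \<bar>s * h k\<bar>) \<longlongrightarrow> 0) (at 0)"
        by simp
      have "\<bar>\<xi> s m k - x k\<bar> \<le> \<bar>s * h k\<bar>" for s
        using \<tau>(1)[OF that] by (auto simp: \<xi>_def P_def)
      then have "\<forall>\<^sub>F s in at 0. norm (\<xi> s m k - x k) \<le> \<bar>s * h k\<bar>"
        by simp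
      then have "((\<lambda>s. \<xi> s m k - x k) \<longlongrightarrow> 0) (at 0)"
        using null by (rule Lim_null_comparison)
      then show "((\<lambda>s. \<xi> s m k) \<longlongrightarrow> x k) (at 0)"
        by (simp add: LIM_zero_iff)
    qed
    show "x \<in> Rn n"
      by fact
    show "\<forall>\<^sub>F s in at 0. \<xi> s m \<in> Rn n"
      using P_Rn that by (auto simp: \<xi>_def topspace_Euclidean_space)
  qed
  \<comment> \<open>Telescoping over the staircase makes the difference quotient an exact finite
    sum, with no remainder term to estimate.\<close>
  have quotient: "(F (\<lambda>k. x k + s * h k) - F x) / s = (\<Sum>m<n. h m * partial_deriv m F (\<xi> s m))"
    if "s \<noteq> 0" for s
  proof -
    have "P s n = (\<lambda>k. x k + s * h k)" "P s 0 = x"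
      using h by (auto simp: P_def fun_eq_iff topspace_Euclidean_space)
    then have "F (\<lambda>k. x k + s * h k) - F x = (\<Sum>m<n. F (P s (Suc m)) - F (P s m))"
      using sum_lessThan_telescope[of "\<lambda>m. F (P s m)" n] by simp
    also have "\<dots> = (\<Sum>m<n. s * (h m * partial_deriv m F (\<xi> s m)))"
      by (intro sum.cong) (auto simp: \<tau>(2) \<xi>_def)
    finally show ?thesis
      using that by (simp flip: sum_distrib_left)
  qed
  have "((\<lambda>s. \<Sum>m<n. h m * partial_deriv m F (\<xi> s m)) \<longlongrightarrow> (\<Sum>i<n. h i * partial_deriv i F x)) (at 0)"
    by (intro tendsto_intros lim) auto
  then have "((\<lambda>s. (F (\<lambda>k. x k + s * h k) - F x) / s) \<longlongrightarrow> (\<Sum>i<n. h i * partial_deriv i F x)) (at 0)"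
    by (rule Lim_transform_eventually) (auto simp: eventually_at_filter quotient)
  then show ?thesis
    by (simp add: DERIV_def)
qed

text \<open>The point \<open>x + t h\<close> serves as a new base point; shifting the parameter by
  \<open>t\<close> reduces the claim to differentiation at 0.\<close>

lemma C1_on_Rn_directional_derivative:
  assumes C1: "C1_on_Rn n F" and x: "x \<in> Rn n" and h: "h \<in> Rn n"
  shows "((\<lambda>s. F (\<lambda>k. x k + s * h k)) has_real_derivative
    (\<Sum>i<n. h i * partial_deriv i F (\<lambda>k. x k + t * h k))) (at t)"
proof -
  have "(\<lambda>k. x k + t * h k) \<in> Rn n"
    using x h by (auto simp: topspace_Euclidean_space)
  from C1_on_Rn_directional_derivative_0[OF C1 this h]
  have "((\<lambda>s. F (\<lambda>k. x k + (s + t) * h k)) has_real_derivative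
      (\<Sum>i<n. h i * partial_deriv i F (\<lambda>k. x k + t * h k))) (at 0)"
    by (simp add: algebra_simps)
  then show ?thesis
    using DERIV_shift[of "\<lambda>s. F (\<lambda>k. x k + s * h k)" _ 0 t] by simp
qed

section \<open>From bounded gradients to Lipschitz continuity\<close>

lemma grad_norm_le_grad_sup:
  "bdd_above (grad_norm n F ` Rn n) \<Longrightarrow> z \<in> Rn n \<Longrightarrow> grad_norm n F z \<le> grad_sup n F"
  unfolding grad_sup_def by (rule cSUP_upper)

lemma grad_sup_nonneg:
  assumes "bdd_above (grad_norm n F ` Rn n)"
  shows "0 \<le> grad_sup n F"
proof -
  have "0 \<le> grad_norm n F (\<lambda>_. 0)"
    by (simp add: grad_norm_def)
  also have "\<dots> \<le> grad_sup n F"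
    by (intro grad_norm_le_grad_sup assms) (simp add: topspace_Euclidean_space)
  finally show ?thesis .
qed

text \<open>By the mean value theorem on the segment, the increment is the inner product of
  \<open>y - x\<close> with the gradient at one point of the segment; Cauchy-Schwarz
  finishes.\<close>

lemma C1_on_Rn_lipschitz:
  assumes C1: "C1_on_Rn n F" and bdd: "bdd_above (grad_norm n F ` Rn n)"
    and x: "x \<in> Rn n" and y: "y \<in> Rn n"
  shows "\<bar>F y - F x\<bar> \<le> grad_sup n F * L2_set (\<lambda>i. y i - x i) {..<n}"
proof -
  define h where "h = (\<lambda>i. y i - x i)"
  have h: "h \<in> Rn n"
    using x y by (auto simp: h_def topspace_Euclidean_space)
  obtain t where
    "F (\<lambda>k. x k + 1 * h k) - F (\<lambda>k. x k + 0 * h k)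
      = (1 - 0) * (\<Sum>i<n. h i * partial_deriv i F (\<lambda>k. x k + t * h k))"
    using MVT2[of 0 1 "\<lambda>s. F (\<lambda>k. x k + s * h k)"
        "\<lambda>t. \<Sum>i<n. h i * partial_deriv i F (\<lambda>k. x k + t * h k)"]
      C1_on_Rn_directional_derivative[OF C1 x h] by auto
  then have eq: "F y - F x = (\<Sum>i<n. h i * partial_deriv i F (\<lambda>k. x k + t * h k))"
    by (simp add: h_def)
  have "\<bar>F y - F x\<bar> \<le> (\<Sum>i<n. \<bar>h i\<bar> * \<bar>partial_deriv i F (\<lambda>k. x k + t * h k)\<bar>)"
    unfolding eq by (rule order.trans[OF sum_abs]) (simp add: abs_mult)
  also have "\<dots> \<le> L2_set h {..<n} * grad_norm n F (\<lambda>k. x k + t * h k)"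
    unfolding grad_norm_def by (rule L2_set_mult_ineq)
  also have "\<dots> \<le> L2_set h {..<n} * grad_sup n F"
    using x h
    by (intro mult_left_mono grad_norm_le_grad_sup bdd) (auto simp: topspace_Euclidean_space)
  finally show ?thesis
    by (simp add: h_def mult.commute)
qed

text \<open>\<open>C1_on_Rn\<close> speaks directly only of partial derivatives. Joint continuity,
  required for measurability of \<open>F (X \<omega>)\<close>, comes from the Lipschitz bound, whose
  right-hand side is continuous in finitely many coordinates.\<close>

lemma C1_on_Rn_continuous:
  assumes C1: "C1_on_Rn n F" and bdd: "bdd_above (grad_norm n F ` Rn n)"
  shows "continuous_on (Rn n) F"
  unfolding continuous_on_def
proof
  fix x assume x: "x \<in> Rn n"
  have id: "((\<lambda>y. y i) \<longlongrightarrow> x i) (at x within Rn n)" for i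
    using continuous_on_subset[OF continuous_on_product_coordinates subset_UNIV, of "Rn n" i] x
    by (auto simp: continuous_on_def)
  have "((\<lambda>y. grad_sup n F * L2_set (\<lambda>i. y i - x i) {..<n})
      \<longlongrightarrow> grad_sup n F * sqrt (\<Sum>i<n. (x i - x i)\<^sup>2)) (at x within Rn n)"
    unfolding L2_set_def by (intro tendsto_intros id)
  then have null: "((\<lambda>y. grad_sup n F * L2_set (\<lambda>i. y i - x i) {..<n}) \<longlongrightarrow> 0) (at x within Rn n)"
    by simp
  have "\<forall>\<^sub>F y in at x within Rn n.
      norm (F y - F x) \<le> grad_sup n F * L2_set (\<lambda>i. y i - x i) {..<n}"
    using C1_on_Rn_lipschitz[OF C1 bdd x] by (auto simp: eventually_at_filter)
  then have "((\<lambda>y. F y - F x) \<longlongrightarrow> 0) (at x within Rn n)"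
    using null by (rule Lim_null_comparison)
  then show "(F \<longlongrightarrow> F x) (at x within Rn n)"
    by (simp add: LIM_zero_iff)
qed

section \<open>Second moment of the Gaussian observation\<close>

lemma normal_law_second_moment:
  assumes "0 \<le> v"
  shows "integrable (normal_law m v) (\<lambda>x. (x - m)\<^sup>2)"
    and "(\<integral>x. (x - m)\<^sup>2 \<partial>normal_law m v) = v"
proof -
  have "integrable (normal_law m v) (\<lambda>x. (x - m)\<^sup>2) \<and> (\<integral>x. (x - m)\<^sup>2 \<partial>normal_law m v) = v"
  proof (cases "v = 0")
    case True
    then show ?thesis
      by (simp add: normal_law_def integral_return integrable_iff_bounded nn_integral_return)
  next
    case False
    with assms have v: "0 < sqrt v"
      by simp
    have "has_bochner_integral lborel (\<lambda>x. normal_density m (sqrt v) x * (x - m)\<^sup>2) v"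
      \<comment> \<open>The central moment of order \<open>2 * k\<close> at \<open>k = 1\<close> is
        the square of the standard deviation \<open>sqrt v\<close>.\<close>
      using normal_moment_even[OF v, of m 1] assms by simp
    then show ?thesis
      using False by (simp add: normal_law_def integrable_density integral_density
          has_bochner_integral_iff)
  qed
  then show "integrable (normal_law m v) (\<lambda>x. (x - m)\<^sup>2)"
    and "(\<integral>x. (x - m)\<^sup>2 \<partial>normal_law m v) = v"
    by auto
qed

lemma quad_form_unit:
  assumes "i < n"
  shows "quad_form n S (\<lambda>k. if k = i then 1 else 0) = S i i"
proof -
  have "quad_form n S (\<lambda>k. if k = i then 1 else 0)
      = (\<Sum>k<n. \<Sum>j<n. if j = i then if k = i then S i i else 0 else 0)"
    unfolding quad_form_def by (intro sum.cong) auto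
  with assms show ?thesis
    by simp
qed

lemma sym_psd_diag_nonneg:
  assumes "sym_psd n S" "i < n"
  shows "0 \<le> S i i"
proof -
  have "(\<lambda>k. if k = i then 1 else 0) \<in> Rn n"
    using assms by (auto simp: topspace_Euclidean_space)
  with assms have "0 \<le> quad_form n S (\<lambda>k. if k = i then 1 else 0)"
    by (auto simp: sym_psd_def)
  with assms show ?thesis
    by (simp add: quad_form_unit)
qed

section \<open>From linear functionals to coordinates and the norm\<close>

lemma gaussian_vector_coordinate_measurable:
  assumes "gaussian_vector n M X \<mu> S"
  shows "(\<lambda>\<omega>. X \<omega> i) \<in> borel_measurable M"
proof -
  have "X \<in> M \<rightarrow>\<^sub>M borel"
    using assms by (auto simp: gaussian_vector_def measurable_restrict_space2_iff)
  moreover have "(\<lambda>x. x i) \<in> borel_measurable (borel :: (nat \<Rightarrow> real) measure)"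
    by (intro borel_measurable_continuous_onI continuous_on_product_coordinates)
  ultimately show ?thesis
    by (rule measurable_compose)
qed

text \<open>Testing the law of linear functionals on the \<open>i\<close>-th unit vector shows that
  coordinate \<open>i\<close> is normal with mean \<open>\<mu> i\<close> and variance
  \<open>S i i\<close>.\<close>

lemma gaussian_vector_coordinate_variance:
  assumes gauss: "gaussian_vector n M X \<mu> S" and psd: "sym_psd n S" and "i < n"
  shows "integrable M (\<lambda>\<omega>. (X \<omega> i - \<mu> i)\<^sup>2)"
    and "(\<integral>\<omega>. (X \<omega> i - \<mu> i)\<^sup>2 \<partial>M) = S i i"
proof -
  define u :: "nat \<Rightarrow> real" where "u = (\<lambda>k. if k = i then 1 else 0)"
  have u: "u \<in> Rn n"
    using \<open>i < n\<close> by (auto simp: u_def topspace_Euclidean_space)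
  have pick: "(\<Sum>k<n. u k * f k) = f i" for f
    using \<open>i < n\<close> by (simp add: u_def if_distrib[of "\<lambda>x. x * _"] cong: if_cong)
  have "distr M borel (\<lambda>\<omega>. \<Sum>k<n. u k * X \<omega> k) = normal_law (\<Sum>k<n. u k * \<mu> k) (quad_form n S u)"
    using gauss u by (simp add: gaussian_vector_def)
  moreover have "quad_form n S u = S i i"
    using \<open>i < n\<close> by (simp add: u_def quad_form_unit)
  ultimately have law: "distr M borel (\<lambda>\<omega>. X \<omega> i) = normal_law (\<mu> i) (S i i)"
    by (simp only: pick)
  note [measurable] = gaussian_vector_coordinate_measurable[OF gauss, of i]
  note moment = normal_law_second_moment[OF sym_psd_diag_nonneg[OF psd \<open>i < n\<close>], of "\<mu> i"]
  show "integrable M (\<lambda>\<omega>. (X \<omega> i - \<mu> i)\<^sup>2)"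
    using moment(1) unfolding law[symmetric] by (subst (asm) integrable_distr_eq) auto
  show "(\<integral>\<omega>. (X \<omega> i - \<mu> i)\<^sup>2 \<partial>M) = S i i"
    using moment(2) unfolding law[symmetric] by (subst (asm) integral_distr) auto
qed

lemma gaussian_vector_second_moment:
  assumes gauss: "gaussian_vector n M X \<mu> S" and psd: "sym_psd n S"
  shows "integrable M (\<lambda>\<omega>. (L2_set (\<lambda>i. X \<omega> i - \<mu> i) {..<n})\<^sup>2)"
    and "(\<integral>\<omega>. (L2_set (\<lambda>i. X \<omega> i - \<mu> i) {..<n})\<^sup>2 \<partial>M) = mat_trace n S"
proof -
  have eq: "(L2_set (\<lambda>i. X \<omega> i - \<mu> i) {..<n})\<^sup>2 = (\<Sum>i<n. (X \<omega> i - \<mu> i)\<^sup>2)" for \<omega>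
    unfolding L2_set_def by (simp add: sum_nonneg)
  note var = gaussian_vector_coordinate_variance[OF gauss psd]
  show "integrable M (\<lambda>\<omega>. (L2_set (\<lambda>i. X \<omega> i - \<mu> i) {..<n})\<^sup>2)"
    unfolding eq by (intro Bochner_Integration.integrable_sum var) auto
  show "(\<integral>\<omega>. (L2_set (\<lambda>i. X \<omega> i - \<mu> i) {..<n})\<^sup>2 \<partial>M) = mat_trace n S"
    unfolding eq mat_trace_def
    by (subst Bochner_Integration.integral_sum) (auto intro!: sum.cong var)
qed

text \<open>This is Minkowski's inequality in L2 for \<open>K * R\<close> and a constant. After
  expanding the square, only the cross term needs an estimate, and its coefficient is
  nonnegative.\<close>

lemma (in prob_space) affine_second_moment_le:
  fixes R :: "'a \<Rightarrow> real"
  assumes R: "random_variable borel R" "integrable M (\<lambda>\<omega>. (R \<omega>)\<^sup>2)"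
    and "expectation (\<lambda>\<omega>. (R \<omega>)\<^sup>2) = v" "0 \<le> K" "0 \<le> d"
  shows "integrable M (\<lambda>\<omega>. (K * R \<omega> + d)\<^sup>2)"
    and "expectation (\<lambda>\<omega>. (K * R \<omega> + d)\<^sup>2) \<le> (K * sqrt v + d)\<^sup>2"
proof -
  have int: "integrable M R"
    by (rule square_integrable_imp_integrable[OF R])
  have eq: "(K * R \<omega> + d)\<^sup>2 = K\<^sup>2 * (R \<omega>)\<^sup>2 + 2 * K * d * R \<omega> + d\<^sup>2" for \<omega>
    by (simp add: power2_eq_square algebra_simps)
  show "integrable M (\<lambda>\<omega>. (K * R \<omega> + d)\<^sup>2)"
    unfolding eq using int R by simp
  \<comment> \<open>Nonnegativity of the variance.\<close>
  have "(expectation R)\<^sup>2 \<le> v"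
    using variance_eq[OF int R(2)] variance_positive[of R] assms(3) by linarith
  then have "expectation R \<le> sqrt v"
    by (rule real_le_rsqrt)
  have "0 \<le> v"
    using assms(3) by (metis integral_nonneg_AE AE_I2 zero_le_power2)
  have "expectation (\<lambda>\<omega>. (K * R \<omega> + d)\<^sup>2) = K\<^sup>2 * v + 2 * K * d * expectation R + d\<^sup>2"
    unfolding eq using int R assms(3) by (simp add: prob_space)
  also have "\<dots> \<le> K\<^sup>2 * v + 2 * K * d * sqrt v + d\<^sup>2"
    using \<open>expectation R \<le> sqrt v\<close> assms by (intro add_mono mult_left_mono) auto
  also have "\<dots> = (K * sqrt v + d)\<^sup>2"
    using \<open>0 \<le> v\<close> by (simp add: power2_sum power_mult_distrib mult_ac)
  finally show "expectation (\<lambda>\<omega>. (K * R \<omega> + d)\<^sup>2) \<le> (K * sqrt v + d)\<^sup>2" .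
qed

lemma (in prob_space) obs_mass_lower_bound:
  assumes gauss: "gaussian_vector n M X \<mu> S" and psd: "sym_psd n S" and \<mu>: "\<mu> \<in> Rn n"
    and C1: "C1_on_Rn n F" and bdd: "bdd_above (grad_norm n F ` Rn n)" and "0 < \<delta>"
  shows "1 - obs_mass M X F A \<delta>
    \<le> (grad_sup n F * sqrt (mat_trace n S) + infdist (F \<mu>) A)\<^sup>2 / \<delta>\<^sup>2"
proof -
  define R where "R \<omega> = L2_set (\<lambda>i. X \<omega> i - \<mu> i) {..<n}" for \<omega>
  let ?K = "grad_sup n F" and ?d = "infdist (F \<mu>) A"
  note [measurable] = gaussian_vector_coordinate_measurable[OF gauss]
  have R [measurable]: "R \<in> borel_measurable M"
    unfolding R_def L2_set_def by measurable
  have X_Rn: "X \<omega> \<in> Rn n" if "\<omega> \<in> space M" for \<omega>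
    using gauss that by (auto simp: gaussian_vector_def measurable_restrict_space2_iff)
  have FX [measurable]: "(\<lambda>\<omega>. F (X \<omega>)) \<in> borel_measurable M"
    using gauss borel_measurable_continuous_on_restrict[OF C1_on_Rn_continuous[OF C1 bdd]]
    by (auto simp: gaussian_vector_def intro: measurable_compose)
  have [measurable]: "(\<lambda>\<omega>. infdist (F (X \<omega>)) A) \<in> borel_measurable M"
    by (rule measurable_compose[OF FX])
      (intro borel_measurable_continuous_onI continuous_intros)
  note second_moment = gaussian_vector_second_moment[OF gauss psd, folded R_def]
  note affine = affine_second_moment_le[OF R second_moment grad_sup_nonneg[OF bdd]
      infdist_nonneg[of "F \<mu>" A]]
  have "1 - obs_mass M X F A \<delta> = prob (space M - {\<omega> \<in> space M. infdist (F (X \<omega>)) A < \<delta>})"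
    using prob_compl[of "{\<omega> \<in> space M. infdist (F (X \<omega>)) A < \<delta>}"] by (simp add: obs_mass_def)
  \<comment> \<open>The absolute value matches the form of \<open>second_moment_method\<close>. The
    inclusion is the triangle inequality through \<open>F \<mu>\<close> followed by the Lipschitz
    bound.\<close>
  also have "\<dots> \<le> prob {\<omega> \<in> space M. \<delta> \<le> \<bar>?K * R \<omega> + ?d\<bar>}"
  proof (rule finite_measure_mono)
    have "infdist (F (X \<omega>)) A \<le> \<bar>?K * R \<omega> + ?d\<bar>" if "\<omega> \<in> space M" for \<omega>
      using infdist_triangle[of "F (X \<omega>)" A "F \<mu>"] C1_on_Rn_lipschitz[OF C1 bdd \<mu> X_Rn[OF that]]
      by (auto simp: R_def dist_real_def)
    then show "space M - {\<omega> \<in> space M. infdist (F (X \<omega>)) A < \<delta>}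
        \<subseteq> {\<omega> \<in> space M. \<delta> \<le> \<bar>?K * R \<omega> + ?d\<bar>}"
      by fastforce
  qed measurable
  also have "\<dots> \<le> expectation (\<lambda>\<omega>. (?K * R \<omega> + ?d)\<^sup>2) / \<delta>\<^sup>2"
    by (intro second_moment_method affine \<open>0 < \<delta>\<close>) measurable
  also have "\<dots> \<le> (?K * sqrt (mat_trace n S) + ?d)\<^sup>2 / \<delta>\<^sup>2"
    by (intro divide_right_mono affine) auto
  finally show ?thesis .
qed

section \<open>Comparison of the two masses and the limit\<close>

theorem proposition3p4:
  fixes a b c :: real
    and \<rho> :: "nat \<Rightarrow> real \<Rightarrow> real"
    and M :: "nat \<Rightarrow> 'a measure"
    and X :: "nat \<Rightarrow> 'a \<Rightarrow> nat \<Rightarrow> real"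
    and \<mu> :: "nat \<Rightarrow> nat \<Rightarrow> real"
    and S :: "nat \<Rightarrow> nat \<Rightarrow> nat \<Rightarrow> real"
    and \<Theta> :: "nat \<Rightarrow> (nat \<Rightarrow> real) \<Rightarrow> real"
  assumes "a \<le> b"
    and "\<And>n. continuous_on {a..b} (\<rho> n)"
    and "\<And>n \<theta>. \<theta> \<in> {a..b} \<Longrightarrow> 0 \<le> \<rho> n \<theta>"
    and "\<And>n. set_integrable lborel {a..b} (\<rho> n)"
    and "\<And>n. 0 < (LINT \<theta>:{a..b}|lborel. \<rho> n \<theta>)"
    and "\<And>n. prob_space (M n)"
    and "\<And>n. \<mu> n \<in> Rn n"
    and "\<And>n. sym_psd n (S n)"
    and "\<And>n. gaussian_vector n (M n) (X n) (\<mu> n) (S n)"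
    and "\<And>n. C1_on_Rn n (\<Theta> n)"
    and "\<And>n. bdd_above (grad_norm n (\<Theta> n) ` Rn n)"
    and "0 < c" and "c < 1"
  shows "(\<forall>n. \<forall>\<delta>>0.
            \<bar>peak_mass {a..b} (\<rho> n) \<delta> - obs_mass (M n) (X n) (\<Theta> n) (maximizers {a..b} (\<rho> n)) \<delta>\<bar>
            \<le> tail_ratio c {a..b} (\<rho> n) \<delta>
              + (grad_sup n (\<Theta> n) * sqrt (mat_trace n (S n))
                 + infdist (\<Theta> n (\<mu> n)) (maximizers {a..b} (\<rho> n)))\<^sup>2 / \<delta>\<^sup>2)
       \<and> ((\<forall>\<delta>>0. (\<lambda>n. tail_ratio c {a..b} (\<rho> n) \<delta>) \<longlonglongrightarrow> 0)
            \<and> (\<lambda>n. (grad_sup n (\<Theta> n))\<^sup>2 * mat_trace n (S n)) \<longlonglongrightarrow> 0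
            \<and> (\<lambda>n. infdist (\<Theta> n (\<mu> n)) (maximizers {a..b} (\<rho> n))) \<longlonglongrightarrow> 0
          \<longrightarrow> (\<forall>\<delta>>0. (\<lambda>n. \<bar>peak_mass {a..b} (\<rho> n) \<delta>
                    - obs_mass (M n) (X n) (\<Theta> n) (maximizers {a..b} (\<rho> n)) \<delta>\<bar>) \<longlonglongrightarrow> 0))"
proof (intro conjI impI allI)
  let ?A = "\<lambda>n. maximizers {a..b} (\<rho> n)"
  let ?diff = "\<lambda>n \<delta>. \<bar>peak_mass {a..b} (\<rho> n) \<delta> - obs_mass (M n) (X n) (\<Theta> n) (?A n) \<delta>\<bar>"
  let ?K = "\<lambda>n. grad_sup n (\<Theta> n)" and ?d = "\<lambda>n. infdist (\<Theta> n (\<mu> n)) (?A n)"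
  let ?bound = "\<lambda>n \<delta>. tail_ratio c {a..b} (\<rho> n) \<delta> + (?K n * sqrt (mat_trace n (S n)) + ?d n)\<^sup>2 / \<delta>\<^sup>2"
  show bound: "?diff n \<delta> \<le> ?bound n \<delta>" if "0 < \<delta>" for n \<delta>
  proof -
    interpret profile a b "\<rho> n"
      by (intro profile.intro assms)
    interpret prob_space "M n"
      by fact
    have "1 - obs_mass (M n) (X n) (\<Theta> n) (?A n) \<delta>
        \<le> (?K n * sqrt (mat_trace n (S n)) + ?d n)\<^sup>2 / \<delta>\<^sup>2"
      by (intro obs_mass_lower_bound assms that)
    moreover have "obs_mass (M n) (X n) (\<Theta> n) (?A n) \<delta> \<le> 1"
      by (simp add: obs_mass_def)
    \<comment> \<open>Both defects from 1 are nonnegative, so the difference of the masses is at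
      most their sum.\<close>
    ultimately show ?thesis
      using peak_mass_bounds[of c \<delta>] assms that by linarith
  qed
  fix \<delta> :: real
  assume lim: "(\<forall>\<delta>>0. (\<lambda>n. tail_ratio c {a..b} (\<rho> n) \<delta>) \<longlonglongrightarrow> 0)
      \<and> (\<lambda>n. (?K n)\<^sup>2 * mat_trace n (S n)) \<longlonglongrightarrow> 0 \<and> ?d \<longlonglongrightarrow> 0" and "0 < \<delta>"
  \<comment> \<open>Since \<open>?K n\<close> is nonnegative it can be moved under the root, which
    exposes the quantity assumed to tend to 0.\<close>
  have "?K n * sqrt (mat_trace n (S n)) = sqrt ((?K n)\<^sup>2 * mat_trace n (S n))" for n
    using grad_sup_nonneg assms by (simp add: real_sqrt_mult)
  moreover have "(\<lambda>n. tail_ratio c {a..b} (\<rho> n) \<delta>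
      + (sqrt ((?K n)\<^sup>2 * mat_trace n (S n)) + ?d n)\<^sup>2 / \<delta>\<^sup>2) \<longlonglongrightarrow> 0 + (sqrt 0 + 0)\<^sup>2 / \<delta>\<^sup>2"
    using lim \<open>0 < \<delta>\<close> by (intro tendsto_intros) auto
  ultimately have "(\<lambda>n. ?bound n \<delta>) \<longlonglongrightarrow> 0"
    by simp
  then show "(\<lambda>n. ?diff n \<delta>) \<longlonglongrightarrow> 0"
    by (rule Lim_null_comparison[rotated]) (use bound[OF \<open>0 < \<delta>\<close>] in auto)
qed

end
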